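(* Let $H$ be a nonzero complex Hilbert space and let $A \subseteq B(H)$ be a $C^*$-algebra containing the unit $e=I_H$. Then for any $X \in A$ we have $\|X\|_m = w(X)$, where $w(X) := \sup \{ | \langle Xh,h \rangle | : h \in H,\ \|h\|=1 \}$ is the numerical radius of $X$.
   Context: $A$ is regarded as an ordered $*$-vector space with its usual involution, $A^+$ the usual cone of positive elements, and (Archimedean) order unit $e=I_H$. A state on $A$ is a $\mathbb{C}$-linear functional $f:A\to\mathbb{C}$ with $f(A^+)\subseteq[0,\infty)$ and $f(I_H)=1$ (this is the usual notion of state on a $C^*$-algebra). The minimal order norm on $A$ is $\|X\|_m:=\sup\{|f(X)| : f:A\to\mathbb{C}\text{ is a state}\}$. *)

theory Defs
  imports "HOL-Analysis.Analysis"
begin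

section \<open>Complex Hilbert spaces\<close>

class complex_vector = real_vector +
  fixes scaleC :: "complex \<Rightarrow> 'a \<Rightarrow> 'a"  (infixr \<open>*\<^sub>C\<close> 75)
  assumes scaleC_add_right: "c *\<^sub>C (x + y) = c *\<^sub>C x + c *\<^sub>C y"
    and scaleC_add_left: "(c + d) *\<^sub>C x = c *\<^sub>C x + d *\<^sub>C x"
    and scaleC_scaleC: "c *\<^sub>C d *\<^sub>C x = (c * d) *\<^sub>C x"
    and scaleC_of_real: "complex_of_real r *\<^sub>C x = r *\<^sub>R x"

text \<open>
  The inner product is linear in the first argument. Since \<^term>\<open>norm\<close> comes from
  \<^class>\<open>real_normed_vector\<close>, the last axiom says both that the inner product is positive
  definite and that it induces the norm (hence the metric and the topology).
\<close>

class complex_inner = complex_vector + real_normed_vector +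
  fixes cinner :: "'a \<Rightarrow> 'a \<Rightarrow> complex"
  assumes cinner_commute: "cinner x y = cnj (cinner y x)"
    and cinner_add_left: "cinner (x + y) z = cinner x z + cinner y z"
    and cinner_scaleC_left: "cinner (c *\<^sub>C x) y = c * cinner x y"
    and cinner_self: "cinner x x = complex_of_real ((norm x)\<^sup>2)"

class chilbert_space = complex_inner + complete_space

subclass (in chilbert_space) banach ..

lemma norm_scaleC: "norm (c *\<^sub>C x) = cmod c * norm (x :: 'a::complex_inner)"
proof -
  have "cinner (c *\<^sub>C x) (c *\<^sub>C x) = c * (cnj c * cinner x x)"
    by (subst cinner_scaleC_left, subst cinner_commute, subst cinner_scaleC_left)
       (simp add: cinner_self)
  then have "complex_of_real ((norm (c *\<^sub>C x))\<^sup>2) = complex_of_real ((cmod c * norm x)\<^sup>2)"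
    by (simp add: cinner_self power_mult_distrib flip: mult.assoc complex_norm_square)
  then have "(norm (c *\<^sub>C x))\<^sup>2 = (cmod c * norm x)\<^sup>2"
    by (simp only: of_real_eq_iff)
  then show ?thesis
    by (simp add: power2_eq_iff_nonneg)
qed

lemma scaleC_scaleR: "c *\<^sub>C r *\<^sub>R x = r *\<^sub>R c *\<^sub>C (x :: 'a::complex_vector)"
  by (metis scaleC_of_real scaleC_scaleC mult.commute)

lemma bounded_linear_scaleC: "bounded_linear (\<lambda>x :: 'a::complex_inner. c *\<^sub>C x)"
  by (rule bounded_linear_intro[where K = "cmod c"])
     (simp_all add: scaleC_add_right scaleC_scaleR norm_scaleC)

section \<open>Bounded operators\<close>

text \<open>
  Elements of \<^typ>\<open>'h \<Rightarrow>\<^sub>L 'h\<close> are bounded and real-linear, with the operator norm;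
  B(H) consists of the complex-linear ones.
\<close>

definition bounded_ops :: "('h::complex_inner \<Rightarrow>\<^sub>L 'h) set" where
  "bounded_ops = {X. \<forall>c h. blinfun_apply X (c *\<^sub>C h) = c *\<^sub>C blinfun_apply X h}"

lift_definition op_scaleC :: "complex \<Rightarrow> ('h::complex_inner \<Rightarrow>\<^sub>L 'h) \<Rightarrow> ('h \<Rightarrow>\<^sub>L 'h)"
  is "\<lambda>c X h. c *\<^sub>C X h"
  by (rule bounded_linear_compose[OF bounded_linear_scaleC])

text \<open>The adjoint exists and is unique for every \<open>X\<close> in B(H), by the Riesz representation theorem.\<close>

definition adj :: "('h::chilbert_space \<Rightarrow>\<^sub>L 'h) \<Rightarrow> ('h \<Rightarrow>\<^sub>L 'h)" where
  "adj X = (THE Y. Y \<in> bounded_ops \<and>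
     (\<forall>g h. cinner (blinfun_apply X g) h = cinner g (blinfun_apply Y h)))"

text \<open>A (not necessarily unital) C*-algebra of operators: a norm-closed *-subalgebra of B(H).\<close>

definition cstar_algebra :: "('h::chilbert_space \<Rightarrow>\<^sub>L 'h) set \<Rightarrow> bool" where
  "cstar_algebra A \<longleftrightarrow>
     A \<subseteq> bounded_ops \<and> 0 \<in> A \<and>
     (\<forall>X\<in>A. \<forall>Y\<in>A. X + Y \<in> A) \<and>
     (\<forall>c. \<forall>X\<in>A. op_scaleC c X \<in> A) \<and>
     (\<forall>X\<in>A. \<forall>Y\<in>A. X o\<^sub>L Y \<in> A) \<and>
     (\<forall>X\<in>A. adj X \<in> A) \<and>
     closed A"

definition positive_cone :: "('h::chilbert_space \<Rightarrow>\<^sub>L 'h) set \<Rightarrow> ('h \<Rightarrow>\<^sub>L 'h) set" where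
  "positive_cone A = {adj Y o\<^sub>L Y | Y. Y \<in> A}"

section \<open>States, minimal order norm, numerical radius\<close>

text \<open>A functional on \<open>A\<close> is a function on the ambient type whose values outside \<open>A\<close> are irrelevant.\<close>

definition is_state ::
  "('h::chilbert_space \<Rightarrow>\<^sub>L 'h) set \<Rightarrow> (('h \<Rightarrow>\<^sub>L 'h) \<Rightarrow> complex) \<Rightarrow> bool" where
  "is_state A f \<longleftrightarrow>
     (\<forall>X\<in>A. \<forall>Y\<in>A. f (X + Y) = f X + f Y) \<and>
     (\<forall>c. \<forall>X\<in>A. f (op_scaleC c X) = c * f X) \<and>
     (\<forall>P\<in>positive_cone A. f P \<in> \<real>\<^sub>\<ge>\<^sub>0) \<and>
     f id_blinfun = 1"

text \<open>
  Both suprema below are over nonempty bounded sets of reals when \<open>H\<close> is nonzero, \<open>A\<close> is a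
  unital C*-algebra and \<open>X \<in> A\<close>: states are contractive, and vector states exist.
\<close>

definition min_order_norm ::
  "('h::chilbert_space \<Rightarrow>\<^sub>L 'h) set \<Rightarrow> ('h \<Rightarrow>\<^sub>L 'h) \<Rightarrow> real" where
  "min_order_norm A X = Sup {cmod (f X) | f. is_state A f}"

definition numerical_radius :: "('h::chilbert_space \<Rightarrow>\<^sub>L 'h) \<Rightarrow> real" where
  "numerical_radius X = Sup {cmod (cinner (blinfun_apply X h) h) | h. norm h = 1}"

end

theory Submission
  imports Defs
begin

text \<open>
  The inequality \<open>w(X) \<le> \<parallel>X\<parallel>\<^sub>m\<close> holds because every unit vector \<open>h\<close> gives a state
  \<open>X \<mapsto> \<langle>Xh,h\<rangle>\<close>.

  For the converse let \<open>f\<close> be a state and rotate \<open>X\<close> by a unimodular scalar so that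
  \<open>f(X) = |f(X)|\<close>. Write \<open>X = a + ib\<close> with \<open>a, b \<in> A\<close> self-adjoint. Since \<open>f\<close> is real on
  self-adjoint elements, \<open>|f(X)| = f(a)\<close>, while \<open>\<langle>ah,h\<rangle> = Re \<langle>Xh,h\<rangle> \<le> w(X)\<close> for all unit
  vectors \<open>h\<close>. It remains to see that \<open>\<langle>ah,h\<rangle> \<le> c\<close> for all unit vectors implies \<open>f(a) \<le> c\<close>
  (lemma \<open>state_selfadjoint_le\<close>). For every \<open>\<epsilon> > 0\<close> the operator \<open>(c + \<epsilon>)I - a\<close> is bounded
  below by \<open>\<epsilon>\<close>, and such an operator has the form \<open>Y\<^sup>*Y\<close> with \<open>Y \<in> A\<close>
  (lemma \<open>strictly_positive_in_cone\<close>), so \<open>f(a) \<le> c + \<epsilon>\<close>.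

  The square root \<open>Y\<close> is found inside \<open>A\<close> without functional calculus: up to a positive factor
  the operator is \<open>I - S\<close> with \<open>S\<close> self-adjoint and \<open>\<parallel>S\<parallel> < 1\<close>, and if \<open>Z\<close> is the fixed point of
  \<open>Z \<mapsto> (S + Z\<^sup>2)/2\<close>, a contraction of a ball of self-adjoint elements, then \<open>(I - Z)\<^sup>2 = I - S\<close>. That adjoints exist is
  the Riesz representation theorem, proved here by minimising \<open>\<parallel>x\<parallel>\<^sup>2 - 2 Re \<phi>(x)\<close>.
\<close>

section \<open>The inner product\<close>

lemma cinner_scaleC_right: "cinner x (c *\<^sub>C y) = cnj c * cinner x (y::'a::complex_inner)"
  by (metis cinner_commute cinner_scaleC_left complex_cnj_mult)

lemma cinner_add_right: "cinner x (y + z) = cinner x y + cinner x (z::'a::complex_inner)"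
  by (metis cinner_commute cinner_add_left complex_cnj_add)

lemma power2_norm_add:
  "(norm (x + y))\<^sup>2 = (norm x)\<^sup>2 + (norm y)\<^sup>2 + 2 * Re (cinner x (y::'a::complex_inner))"
proof -
  have "complex_of_real ((norm (x + y))\<^sup>2)
      = of_real ((norm x)\<^sup>2) + of_real ((norm y)\<^sup>2) + (cinner x y + cnj (cinner x y))"
    unfolding cinner_self[symmetric] cinner_commute[of x y, symmetric]
    by (simp add: cinner_add_left cinner_add_right flip: cinner_commute[of y x])
  then have "Re (complex_of_real ((norm (x + y))\<^sup>2))
      = Re (of_real ((norm x)\<^sup>2) + of_real ((norm y)\<^sup>2) + (cinner x y + cnj (cinner x y)))"
    by (rule arg_cong)
  then show ?thesis by simp
qed

lemma unimodular_rotation: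
  obtains u where "cmod u = 1" "u * c = complex_of_real (cmod c)"
proof
  show "cmod (cis (- Arg c)) = 1" by simp
  have "cis (- Arg c) * c = cis (- Arg c) * rcis (cmod c) (Arg c)"
    by (simp add: rcis_cmod_Arg)
  also have "\<dots> = complex_of_real (cmod c)"
    by (simp add: rcis_def cis_mult mult.left_commute)
  finally show "cis (- Arg c) * c = complex_of_real (cmod c)" .
qed

text \<open>The norm satisfies the triangle inequality by its class axioms, and the Cauchy-Schwarz
  inequality follows from it, rather than the other way round.\<close>

lemma Re_cinner_le: "Re (cinner x y) \<le> norm x * norm (y::'a::complex_inner)"
proof -
  have "(norm (x + y))\<^sup>2 \<le> (norm x + norm y)\<^sup>2"
    by (simp add: norm_triangle_ineq power_mono)
  then show ?thesis by (simp add: power2_norm_add power2_sum)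
qed

lemma cinner_Cauchy_Schwarz: "cmod (cinner x y) \<le> norm x * norm (y::'a::complex_inner)"
proof -
  obtain u where u: "cmod u = 1" "u * cinner x y = of_real (cmod (cinner x y))"
    by (rule unimodular_rotation)
  have "cmod (cinner x y) = Re (cinner (u *\<^sub>C x) y)"
    by (simp add: cinner_scaleC_left u)
  also have "\<dots> \<le> norm x * norm y"
    using Re_cinner_le[of "u *\<^sub>C x" y] by (simp add: norm_scaleC u)
  finally show ?thesis .
qed

lemma bounded_bilinear_cinner:
  "bounded_bilinear (cinner :: 'a::complex_inner \<Rightarrow> 'a \<Rightarrow> complex)"
proof
  show "cinner (r *\<^sub>R a) b = r *\<^sub>R cinner a b" for r and a b :: 'a
    by (simp add: cinner_scaleC_left scaleR_conv_of_real flip: scaleC_of_real)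
  show "cinner a (r *\<^sub>R b) = r *\<^sub>R cinner a b" for r and a b :: 'a
    by (simp add: cinner_scaleC_right scaleR_conv_of_real flip: scaleC_of_real)
  show "\<exists>K. \<forall>a b :: 'a. cmod (cinner a b) \<le> norm a * norm b * K"
    by (intro exI[of _ 1]) (simp add: cinner_Cauchy_Schwarz)
qed (simp_all add: cinner_add_left cinner_add_right)

interpretation cinner: bounded_bilinear "cinner :: 'a::complex_inner \<Rightarrow> 'a \<Rightarrow> complex"
  by (rule bounded_bilinear_cinner)

lemma cinner_ext_right:
  assumes "\<And>g. cinner g x = cinner g (y::'a::complex_inner)"
  shows "x = y"
proof -
  have "cinner (x - y) (x - y) = 0"
    by (simp add: cinner.diff_right assms)
  then show ?thesis by (simp add: cinner_self)
qed

lemma parallelogram_law: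
  "(norm (x + y))\<^sup>2 + (norm (x - y))\<^sup>2 = 2 * (norm x)\<^sup>2 + 2 * (norm (y::'a::complex_inner))\<^sup>2"
  using power2_norm_add[of x y] power2_norm_add[of x "- y"] by (simp add: cinner.minus_right)

section \<open>Riesz representation and adjoints\<close>

lemma Riesz_representation:
  fixes \<phi> :: "'h::chilbert_space \<Rightarrow> complex"
  assumes bl: "bounded_linear \<phi>" and hom: "\<And>c x. \<phi> (c *\<^sub>C x) = c * \<phi> x"
  shows "\<exists>k. \<forall>g. \<phi> g = cinner g k"
proof -
  define J where "J x = (norm x)\<^sup>2 - 2 * Re (\<phi> x)" for x
  define m where "m = Inf (range J)"
  interpret \<phi>: bounded_linear \<phi> by (rule bl)
  obtain K where K: "\<And>x. cmod (\<phi> x) \<le> norm x * K" using \<phi>.bounded by blast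
  have J_lower: "- K\<^sup>2 \<le> J x" for x
  proof -
    have "Re (\<phi> x) \<le> norm x * K" using K[of x] complex_Re_le_cmod[of "\<phi> x"] by linarith
    moreover have "0 \<le> (norm x - K)\<^sup>2" by simp
    ultimately show ?thesis by (simp add: J_def power2_diff)
  qed
  have m_le: "m \<le> J x" for x
    unfolding m_def using J_lower by (intro cInf_lower bdd_belowI2[where m = "- K\<^sup>2"]) auto
  have "\<exists>x. J x < m + inverse (real (Suc n))" for n
  proof -
    have "\<exists>y\<in>range J. y < m + inverse (real (Suc n))"
      unfolding m_def by (rule cInf_lessD) (simp_all del: of_nat_Suc)
    then show ?thesis by blast
  qed
  then obtain x where x: "\<And>n. J (x n) < m + inverse (real (Suc n))" by metis
  \<comment> \<open>The parallelogram law makes minimising sequences Cauchy.\<close>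
  have close: "(norm (y - z))\<^sup>2 \<le> 2 * (J y - m) + 2 * (J z - m)" for y z
  proof -
    have "J ((1/2) *\<^sub>R (y + z)) = (norm (y + z))\<^sup>2 / 4 - (Re (\<phi> y) + Re (\<phi> z))"
      unfolding J_def norm_scaleR \<phi>.scaleR \<phi>.add
      by (simp add: power_mult_distrib power2_eq_square field_simps)
    then show ?thesis
      using m_le[of "(1/2) *\<^sub>R (y + z)"] parallelogram_law[of y z] by (simp add: J_def)
  qed
  have "Cauchy x"
  proof (rule metric_CauchyI)
    fix e :: real assume e: "e > 0"
    obtain N where N: "inverse (real (Suc N)) < e\<^sup>2 / 4"
      using reals_Archimedean[of "e\<^sup>2 / 4"] e by auto
    have "dist (x i) (x j) < e" if "i \<ge> N" "j \<ge> N" for i j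
    proof -
      have near: "J (x n) - m < e\<^sup>2 / 4" if "n \<ge> N" for n
      proof -
        have "inverse (real (Suc n)) \<le> inverse (real (Suc N))"
          using that by (intro le_imp_inverse_le) auto
        then show ?thesis using x[of n] N by linarith
      qed
      have "2 * (J (x i) - m) + 2 * (J (x j) - m) < 4 * (e\<^sup>2 / 4)"
        using near[OF that(1)] near[OF that(2)] by simp
      with close[of "x i" "x j"] have "(norm (x i - x j))\<^sup>2 < e\<^sup>2" by simp
      then show ?thesis using e by (simp add: dist_norm power2_less_imp_less)
    qed
    then show "\<exists>M. \<forall>i\<ge>M. \<forall>j\<ge>M. dist (x i) (x j) < e" by blast
  qed
  then obtain k where k: "x \<longlonglongrightarrow> k"
    using Cauchy_convergent convergent_def by blast
  have "(\<lambda>n. J (x n)) \<longlonglongrightarrow> J k"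
    unfolding J_def by (intro tendsto_intros \<phi>.tendsto k)
  moreover have "(\<lambda>n. m + inverse (real (Suc n))) \<longlonglongrightarrow> m + 0"
    by (intro tendsto_intros LIMSEQ_inverse_real_of_nat)
  ultimately have "J k \<le> m + 0"
    by (rule LIMSEQ_le) (meson x less_imp_le)
  then have min: "J k \<le> J y" for y using m_le[of y] by simp
  \<comment> \<open>The first variation of \<open>J\<close> vanishes at the minimiser \<open>k\<close>.\<close>
  have Re_eq: "Re (\<phi> g) = Re (cinner g k)" for g
  proof -
    define d where "d = Re (cinner g k) - Re (\<phi> g)"
    have quad: "0 \<le> 2 * t * d + t\<^sup>2 * (norm g)\<^sup>2" for t
    proof -
      have "J (k + t *\<^sub>R g) = J k + 2 * t * d + t\<^sup>2 * (norm g)\<^sup>2"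
        using cinner_commute[of k g]
        by (simp add: J_def d_def power2_norm_add \<phi>.add \<phi>.scaleR cinner.scaleR_right
            power_mult_distrib algebra_simps)
      then show ?thesis using min[of "k + t *\<^sub>R g"] by linarith
    qed
    \<comment> \<open>Adding 1 keeps \<open>s\<close> positive when \<open>g = 0\<close>.\<close>
    define s where "s = (norm g)\<^sup>2 + 1"
    have s: "s > 0" "(norm g)\<^sup>2 = s - 1" by (auto simp: s_def add_nonneg_pos)
    have "2 * (- d / s) * d + (- d / s)\<^sup>2 * (norm g)\<^sup>2 = - (d\<^sup>2 * (s + 1)) / s\<^sup>2"
      unfolding s(2) using s(1) by (simp add: field_simps power2_eq_square)
    then have "0 \<le> - (d\<^sup>2 * (s + 1)) / s\<^sup>2"
      using quad[of "- d / s"] by (simp only:)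
    then have "0 \<le> - (d\<^sup>2 * (s + 1)) / s\<^sup>2 * s\<^sup>2"
      by (rule mult_nonneg_nonneg) simp
    then have "d\<^sup>2 * (s + 1) \<le> 0"
      using s(1) by simp
    then have "d = 0" using s by (simp add: mult_le_0_iff)
    then show ?thesis by (simp add: d_def)
  qed
  have "\<phi> g = cinner g k" for g
  proof (rule complex_eqI)
    show "Re (\<phi> g) = Re (cinner g k)" by (rule Re_eq)
    show "Im (\<phi> g) = Im (cinner g k)"
      using Re_eq[of "\<i> *\<^sub>C g"] by (simp add: hom cinner_scaleC_left)
  qed
  then show ?thesis by blast
qed

lemma adjoint_exists:
  fixes X :: "'h::chilbert_space \<Rightarrow>\<^sub>L 'h"
  assumes X: "X \<in> bounded_ops"
  shows "\<exists>Y. Y \<in> bounded_ops \<and> (\<forall>g h. cinner (X g) h = cinner g (Y h))"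
proof -
  have "\<exists>k. \<forall>g. cinner (X g) h = cinner g k" for h
  proof (rule Riesz_representation)
    show "bounded_linear (\<lambda>g. cinner (X g) h)"
      by (rule bounded_linear_compose[OF cinner.bounded_linear_left blinfun.bounded_linear_right])
    show "cinner (X (c *\<^sub>C g)) h = c * cinner (X g) h" for c g
      using X by (simp add: bounded_ops_def cinner_scaleC_left)
  qed
  then obtain Y where Y: "\<And>g h. cinner (X g) h = cinner g (Y h)" by metis
  have scaleC: "Y (c *\<^sub>C h) = c *\<^sub>C Y h" for c h
    by (rule cinner_ext_right) (simp add: Y[symmetric] cinner_scaleC_right)
  have "bounded_linear Y"
  proof (rule bounded_linear_intro[where K = "norm X"])
    show "Y (x + y) = Y x + Y y" for x y
      by (rule cinner_ext_right) (simp add: Y[symmetric] cinner_add_right)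
    show "Y (r *\<^sub>R x) = r *\<^sub>R Y x" for r x
      using scaleC[of "of_real r" x] by (simp add: scaleC_of_real)
    show "norm (Y h) \<le> norm h * norm X" for h
    proof (cases "Y h = 0")
      case False
      have "(norm (Y h))\<^sup>2 = Re (cinner (X (Y h)) h)"
        by (simp add: Y cinner_self)
      also have "\<dots> \<le> norm (X (Y h)) * norm h" by (rule Re_cinner_le)
      also have "\<dots> \<le> norm X * norm (Y h) * norm h"
        by (intro mult_right_mono norm_blinfun) auto
      finally have "norm (Y h) * norm (Y h) \<le> (norm h * norm X) * norm (Y h)"
        by (simp add: power2_eq_square mult_ac)
      then show ?thesis using False by simp
    qed auto
  qed
  then show ?thesis
    using Y scaleC
    by (intro exI[of _ "Blinfun Y"]) (simp add: bounded_ops_def bounded_linear_Blinfun_apply)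
qed

lemma adj_eqI:
  fixes X Y :: "'h::chilbert_space \<Rightarrow>\<^sub>L 'h"
  assumes "Y \<in> bounded_ops" "\<And>g h. cinner (X g) h = cinner g (Y h)"
  shows "adj X = Y"
  unfolding adj_def
proof (rule the_equality)
  fix Z :: "'h \<Rightarrow>\<^sub>L 'h"
  assume "Z \<in> bounded_ops \<and> (\<forall>g h. cinner (X g) h = cinner g (Z h))"
  then show "Z = Y"
    by (intro blinfun_eqI cinner_ext_right) (metis assms(2))
qed (use assms in auto)

lemma cinner_adj_right:
  "X \<in> bounded_ops \<Longrightarrow> cinner g (adj X h) = cinner (X g) h"
  using adjoint_exists[of X] adj_eqI[of _ X] by metis

lemma cinner_adj_left:
  "X \<in> bounded_ops \<Longrightarrow> cinner (adj X g) h = cinner g (X h)"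
  by (metis cinner_adj_right cinner_commute)

section \<open>Self-adjoint operators\<close>

text \<open>Stated through the inner product, so that it makes sense without \<^const>\<open>adj\<close> and visibly
  defines a closed set. For complex-linear \<open>X\<close> it amounts to \<open>adj X = X\<close>.\<close>

definition selfadjoint :: "('h::chilbert_space \<Rightarrow>\<^sub>L 'h) \<Rightarrow> bool" where
  "selfadjoint X \<longleftrightarrow> (\<forall>g h. cinner (X g) h = cinner g (X h))"

lemma adj_selfadjoint: "X \<in> bounded_ops \<Longrightarrow> selfadjoint X \<Longrightarrow> adj X = X"
  by (rule adj_eqI) (auto simp: selfadjoint_def)

lemma closed_selfadjoint: "closed {X. selfadjoint X}"
  unfolding selfadjoint_def
  by (intro closed_Collect_all closed_Collect_eq continuous_intros
      cinner.continuous_on blinfun.continuous_on)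

lemma selfadjoint_id: "selfadjoint id_blinfun"
  by (simp add: selfadjoint_def)

lemma selfadjoint_add: "selfadjoint X \<Longrightarrow> selfadjoint Y \<Longrightarrow> selfadjoint (X + Y)"
  by (simp add: selfadjoint_def blinfun.add_left cinner_add_left cinner_add_right)

lemma selfadjoint_scaleR: "selfadjoint X \<Longrightarrow> selfadjoint (r *\<^sub>R X)"
  by (simp add: selfadjoint_def blinfun.scaleR_left cinner.scaleR_left cinner.scaleR_right)

lemma selfadjoint_diff: "selfadjoint X \<Longrightarrow> selfadjoint Y \<Longrightarrow> selfadjoint (X - Y)"
  by (simp add: selfadjoint_def blinfun.diff_left cinner.diff_left cinner.diff_right)

lemma selfadjoint_square: "selfadjoint X \<Longrightarrow> selfadjoint (X o\<^sub>L X)"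
  by (simp add: selfadjoint_def)

lemma selfadjoint_norm_le:
  fixes S :: "'h::chilbert_space \<Rightarrow>\<^sub>L 'h"
  assumes sa: "selfadjoint S" and bound: "\<And>h. \<bar>Re (cinner (S h) h)\<bar> \<le> r * (norm h)\<^sup>2"
    and r: "0 \<le> r"
  shows "norm S \<le> r"
proof (rule norm_blinfun_bound[OF r])
  fix g
  have polar: "2 * Re (cinner (S g) h) \<le> r * ((norm g)\<^sup>2 + (norm h)\<^sup>2)" for h
  proof -
    have "cinner (S h) g = cnj (cinner (S g) h)"
      using sa by (metis selfadjoint_def cinner_commute)
    then have "Re (cinner (S (g + h)) (g + h)) - Re (cinner (S (g - h)) (g - h))
        = 4 * Re (cinner (S g) h)"
      by (simp add: blinfun.add_right blinfun.diff_right cinner.add_left cinner.add_right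
          cinner.diff_left cinner.diff_right)
    moreover have "r * (norm (g + h))\<^sup>2 + r * (norm (g - h))\<^sup>2
        = 2 * (r * ((norm g)\<^sup>2 + (norm h)\<^sup>2))"
      using arg_cong[OF parallelogram_law[of g h], of "\<lambda>x. r * x"] by (simp add: algebra_simps)
    ultimately show ?thesis using bound[of "g + h"] bound[of "g - h"] by linarith
  qed
  show "norm (S g) \<le> r * norm g"
  proof (cases "g = 0 \<or> S g = 0")
    case True
    then show ?thesis using r by auto
  next
    case False
    \<comment> \<open>Polarisation is applied to the multiple of \<open>S g\<close> that has the norm of \<open>g\<close>.\<close>
    define t where "t = norm g / norm (S g)"
    have "2 * (t * (norm (S g))\<^sup>2) \<le> r * ((norm g)\<^sup>2 + (t * norm (S g))\<^sup>2)"
      using polar[of "t *\<^sub>R S g"]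
      by (simp add: cinner.scaleR_right cinner_self power_mult_distrib)
    moreover have "t * norm (S g) = norm g" using False by (simp add: t_def)
    moreover have "t * (norm (S g))\<^sup>2 = norm g * norm (S g)"
      using False by (simp add: t_def power2_eq_square)
    ultimately have "2 * (norm g * norm (S g)) \<le> r * ((norm g)\<^sup>2 + (norm g)\<^sup>2)"
      by simp
    then have "norm (S g) * norm g \<le> (r * norm g) * norm g"
      by (simp add: power2_eq_square algebra_simps)
    then show ?thesis using False by simp
  qed
qed

section \<open>Square roots in a unital C*-algebra\<close>

lemma blinfun_apply_op_scaleC [simp]: "blinfun_apply (op_scaleC c X) h = c *\<^sub>C X h"
  by transfer simp

lemma op_scaleC_of_real: "op_scaleC (complex_of_real r) X = r *\<^sub>R X"
  by (rule blinfun_eqI) (simp add: scaleC_of_real blinfun.scaleR_left)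

context
  fixes A :: "('h::chilbert_space \<Rightarrow>\<^sub>L 'h) set"
  assumes A: "cstar_algebra A"
begin

lemma cstar_bounded_ops: "X \<in> A \<Longrightarrow> X \<in> bounded_ops"
  and cstar_add: "X \<in> A \<Longrightarrow> Y \<in> A \<Longrightarrow> X + Y \<in> A"
  and cstar_scaleC: "X \<in> A \<Longrightarrow> op_scaleC c X \<in> A"
  and cstar_compose: "X \<in> A \<Longrightarrow> Y \<in> A \<Longrightarrow> X o\<^sub>L Y \<in> A"
  and cstar_adj: "X \<in> A \<Longrightarrow> adj X \<in> A"
  and cstar_zero: "0 \<in> A"
  and cstar_closed: "closed A"
  using A by (auto simp: cstar_algebra_def)

lemma cstar_scaleR: "X \<in> A \<Longrightarrow> r *\<^sub>R X \<in> A"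
  using cstar_scaleC[of X "of_real r"] by (simp add: op_scaleC_of_real)

lemma cstar_diff: "X \<in> A \<Longrightarrow> Y \<in> A \<Longrightarrow> X - Y \<in> A"
  using cstar_add[of X "(- 1) *\<^sub>R Y"] cstar_scaleR[of Y "- 1"] by simp

text \<open>The map \<open>Y \<mapsto> (S + Y\<^sup>2)/2\<close> preserves the complete set \<open>B\<close> of self-adjoint elements of \<open>A\<close> of
  norm at most \<open>r\<close> and contracts it by the factor \<open>r\<close>. A fixed point \<open>Y\<close> satisfies
  \<open>2Y - Y\<^sup>2 = S\<close>, that is, \<open>(I - Y)\<^sup>2 = I - S\<close>.\<close>

lemma sqrt_id_minus_contraction:
  assumes I: "id_blinfun \<in> A" and S: "S \<in> A" "selfadjoint S" and r: "norm S \<le> r" "r < 1"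
  shows "\<exists>Z\<in>A. selfadjoint Z \<and> Z o\<^sub>L Z = id_blinfun - S"
proof -
  define B where "B = A \<inter> {Y. selfadjoint Y} \<inter> cball 0 r"
  define F where "F Y = (1/2) *\<^sub>R (S + (Y o\<^sub>L Y))" for Y
  have r0: "0 \<le> r" using r norm_ge_zero[of S] by linarith
  have "complete B"
    unfolding B_def complete_eq_closed
    by (intro closed_Int cstar_closed closed_selfadjoint closed_cball)
  moreover have "B \<noteq> {}"
  proof -
    have "0 \<in> B"
      using cstar_zero r0
      by (simp add: B_def selfadjoint_def cinner.zero_left cinner.zero_right)
    then show ?thesis by blast
  qed
  moreover have "F Y \<in> B" if Y: "Y \<in> B" for Y
  proof -
    have nY: "norm Y \<le> r" using Y by (simp add: B_def)
    have "norm (S + (Y o\<^sub>L Y)) \<le> r + r * r"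
      using r0 nY
      by (intro norm_triangle_mono r order_trans[OF norm_blinfun_compose] mult_mono) auto
    moreover have "r * r \<le> r * 1" using r r0 by (intro mult_left_mono) auto
    ultimately have "norm (F Y) \<le> r" by (simp add: F_def)
    then show ?thesis
      using Y S unfolding B_def F_def
      by (auto intro!: cstar_scaleR cstar_add cstar_compose selfadjoint_scaleR selfadjoint_add
          selfadjoint_square)
  qed
  moreover have "dist (F Y) (F Z) \<le> r * dist Y Z" if YZ: "Y \<in> B" "Z \<in> B" for Y Z
  proof -
    have n: "norm Y \<le> r" "norm Z \<le> r" using YZ by (simp_all add: B_def)
    have "F Y - F Z = (1/2) *\<^sub>R ((Y o\<^sub>L (Y - Z)) + ((Y - Z) o\<^sub>L Z))"
      by (rule blinfun_eqI)
        (simp add: F_def blinfun.bilinear_simps algebra_simps)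
    moreover have "norm ((Y o\<^sub>L (Y - Z)) + ((Y - Z) o\<^sub>L Z)) \<le> r * norm (Y - Z) + norm (Y - Z) * r"
      using r0 n
      by (intro norm_triangle_mono order_trans[OF norm_blinfun_compose] mult_mono) auto
    ultimately have "norm (F Y - F Z) \<le> (r * norm (Y - Z) + norm (Y - Z) * r) / 2" by simp
    then show ?thesis by (simp add: dist_norm)
  qed
  ultimately have "\<exists>!Y\<in>B. F Y = Y"
    using r r0 by (intro Banach_fix[where c = r]) auto
  then obtain Y where Y: "Y \<in> B" "F Y = Y" by blast
  have Y2: "S h + Y (Y h) = 2 *\<^sub>R Y h" for h
  proof -
    have "Y h = F Y h" using Y by simp
    then have "Y h = (1/2) *\<^sub>R (S h + Y (Y h))"
      unfolding F_def by (simp add: blinfun.add_left blinfun.scaleR_left)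
    then have "2 *\<^sub>R Y h = 2 *\<^sub>R ((1/2) *\<^sub>R (S h + Y (Y h)))" by (rule arg_cong)
    then show ?thesis by simp
  qed
  have "(id_blinfun - Y) o\<^sub>L (id_blinfun - Y) = id_blinfun - S"
  proof (rule blinfun_eqI)
    show "((id_blinfun - Y) o\<^sub>L (id_blinfun - Y)) h = (id_blinfun - S) h" for h
      using Y2[of h] by (simp add: blinfun.bilinear_simps algebra_simps scaleR_2)
  qed
  then show ?thesis
    using Y I by (intro bexI[of _ "id_blinfun - Y"])
      (auto simp: B_def intro!: selfadjoint_diff selfadjoint_id cstar_diff)
qed

text \<open>If \<open>\<epsilon>I \<le> T \<le> MI\<close> in the sense of quadratic forms, then \<open>S = I - T/M\<close> satisfies
  \<open>0 \<le> S \<le> (1 - \<epsilon>/M)I\<close> and has a norm below 1.\<close>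

lemma strictly_positive_in_cone:
  assumes I: "id_blinfun \<in> A" and T: "T \<in> A" "selfadjoint T" and e: "\<epsilon> > 0"
    and lower: "\<And>h. \<epsilon> * (norm h)\<^sup>2 \<le> Re (cinner (T h) h)"
  shows "T \<in> positive_cone A"
proof -
  define M where "M = norm T + \<epsilon>"
  define S where "S = id_blinfun - (1/M) *\<^sub>R T"
  have M: "M > 0" "\<epsilon> \<le> M" using e by (auto simp: M_def add_nonneg_pos)
  have S: "S \<in> A" "selfadjoint S"
    unfolding S_def using I T
    by (auto intro!: cstar_diff cstar_scaleR selfadjoint_diff selfadjoint_scaleR selfadjoint_id)
  have "norm S \<le> 1 - \<epsilon> / M"
  proof (rule selfadjoint_norm_le[OF S(2)])
    fix h
    have "Re (cinner (T h) h) \<le> norm (T h) * norm h" by (rule Re_cinner_le)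
    also have "\<dots> \<le> norm T * norm h * norm h" by (intro mult_right_mono norm_blinfun) auto
    also have "\<dots> \<le> M * (norm h)\<^sup>2"
      using e by (simp add: M_def power2_eq_square algebra_simps)
    finally have upper: "Re (cinner (T h) h) / M \<le> (norm h)\<^sup>2"
      using M by (simp add: field_simps)
    have lower': "\<epsilon> / M * (norm h)\<^sup>2 \<le> Re (cinner (T h) h) / M"
      using lower[of h] M by (simp add: field_simps)
    have "Re (cinner (S h) h) = (norm h)\<^sup>2 - Re (cinner (T h) h) / M"
      by (simp add: S_def blinfun.bilinear_simps cinner.diff_left cinner.scaleR_left cinner_self)
    then show "\<bar>Re (cinner (S h) h)\<bar> \<le> (1 - \<epsilon> / M) * (norm h)\<^sup>2"
      using upper lower' by (simp add: left_diff_distrib)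
  qed (use M in simp)
  moreover have "1 - \<epsilon> / M < 1" using M e by simp
  ultimately obtain Z where Z: "Z \<in> A" "selfadjoint Z" "Z o\<^sub>L Z = id_blinfun - S"
    using sqrt_id_minus_contraction[OF I S] by blast
  define Y where "Y = sqrt M *\<^sub>R Z"
  have Y: "Y \<in> A" "selfadjoint Y"
    unfolding Y_def using Z by (auto intro: cstar_scaleR selfadjoint_scaleR)
  have "Y o\<^sub>L Y = M *\<^sub>R (Z o\<^sub>L Z)"
    using M by (intro blinfun_eqI) (simp add: Y_def blinfun.bilinear_simps)
  also have "\<dots> = T"
    using M by (simp add: Z S_def)
  finally have "T = adj Y o\<^sub>L Y"
    using Y by (simp add: adj_selfadjoint cstar_bounded_ops)
  then show ?thesis using Y by (auto simp: positive_cone_def)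
qed

section \<open>States and the numerical radius\<close>

lemma state_selfadjoint_le:
  assumes I: "id_blinfun \<in> A" and f: "is_state A f" and a: "a \<in> A" "selfadjoint a"
    and upper: "\<And>h. Re (cinner (a h) h) \<le> c * (norm h)\<^sup>2"
  shows "f a \<in> \<real>" and "Re (f a) \<le> c"
proof -
  have pos: "of_real (c + \<epsilon>) - f a \<in> \<real>\<^sub>\<ge>\<^sub>0" if e: "\<epsilon> > 0" for \<epsilon>
  proof -
    define T where "T = (c + \<epsilon>) *\<^sub>R id_blinfun - a"
    have T: "T \<in> A" "selfadjoint T"
      unfolding T_def using a I
      by (auto intro!: cstar_diff cstar_scaleR selfadjoint_diff selfadjoint_scaleR selfadjoint_id)
    have "T \<in> positive_cone A"
    proof (rule strictly_positive_in_cone[OF I T e])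
      show "\<epsilon> * (norm h)\<^sup>2 \<le> Re (cinner (T h) h)" for h
        using upper[of h]
        by (simp add: T_def blinfun.bilinear_simps cinner.diff_left cinner.scaleR_left cinner_self
            algebra_simps)
    qed
    then have "f T \<in> \<real>\<^sub>\<ge>\<^sub>0" using f by (simp add: is_state_def)
    moreover have "T = op_scaleC (of_real (c + \<epsilon>)) id_blinfun + op_scaleC (of_real (- 1)) a"
      unfolding op_scaleC_of_real T_def by simp
    then have "f T = of_real (c + \<epsilon>) * f id_blinfun + of_real (- 1) * f a"
      using f a I cstar_scaleC unfolding is_state_def by metis
    ultimately show ?thesis using f by (simp add: is_state_def)
  qed
  have "of_real (c + 1) - (of_real (c + 1) - f a) \<in> \<real>"
    by (rule Reals_diff[OF Reals_of_real nonneg_Reals_subset_Reals[THEN subsetD, OF pos]]) simp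
  then show "f a \<in> \<real>" by simp
  show "Re (f a) \<le> c"
  proof (rule field_le_epsilon)
    show "Re (f a) \<le> c + \<epsilon>" if "\<epsilon> > 0" for \<epsilon>
      using pos[OF that] by (simp add: complex_nonneg_Reals_iff)
  qed
qed

lemma state_selfadjoint_real:
  assumes "id_blinfun \<in> A" "is_state A f" "a \<in> A" "selfadjoint a"
  shows "f a \<in> \<real>"
proof (rule state_selfadjoint_le[OF assms])
  show "Re (cinner (a h) h) \<le> norm a * (norm h)\<^sup>2" for h
  proof -
    have "Re (cinner (a h) h) \<le> norm (a h) * norm h" by (rule Re_cinner_le)
    also have "\<dots> \<le> norm a * norm h * norm h" by (intro mult_right_mono norm_blinfun) auto
    finally show ?thesis by (simp add: power2_eq_square mult_ac)
  qed
qed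

text \<open>Splitting \<open>B\<close> into its self-adjoint parts reduces this to \<open>state_selfadjoint_le\<close>: the imaginary
  part contributes nothing to the real part of \<open>f B\<close>, nor to that of \<open>\<langle>Bh,h\<rangle>\<close>.\<close>

lemma state_Re_le:
  assumes I: "id_blinfun \<in> A" and f: "is_state A f" and B: "B \<in> A"
    and upper: "\<And>h. Re (cinner (B h) h) \<le> c * (norm h)\<^sup>2"
  shows "Re (f B) \<le> c"
proof -
  define a where "a = (1/2) *\<^sub>R (B + adj B)"
  define b where "b = op_scaleC (- \<i>/2) (B - adj B)"
  note adj_simps = cinner_adj_left[OF cstar_bounded_ops[OF B]]
    cinner_adj_right[OF cstar_bounded_ops[OF B]]
  have a: "a \<in> A" "selfadjoint a"
    using B cstar_adj
    by (auto simp: a_def selfadjoint_def blinfun.bilinear_simps cinner.scaleR_left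
        cinner.scaleR_right cinner_add_left cinner_add_right adj_simps
        intro!: cstar_scaleR cstar_add)
  have b: "b \<in> A" "selfadjoint b"
    using B cstar_adj
    by (auto simp: b_def selfadjoint_def blinfun.bilinear_simps cinner_scaleC_left
        cinner_scaleC_right cinner.diff_left cinner.diff_right adj_simps algebra_simps
        intro!: cstar_scaleC cstar_diff)
  have "op_scaleC \<i> b = op_scaleC (of_real (1/2)) (B - adj B)"
    by (rule blinfun_eqI) (simp add: b_def scaleC_scaleC)
  then have "op_scaleC \<i> b = (1/2) *\<^sub>R (B - adj B)"
    by (simp only: op_scaleC_of_real)
  then have "B = a + op_scaleC \<i> b"
    by (simp add: a_def scaleR_add_right scaleR_diff_right flip: scaleR_add_left)
  then have "f B = f a + \<i> * f b"
    using f a b cstar_scaleC unfolding is_state_def by metis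
  moreover have "f b \<in> \<real>" by (rule state_selfadjoint_real[OF I f b])
  ultimately have "Re (f B) = Re (f a)"
    by (auto elim: Reals_cases)
  moreover have "Re (cinner (a h) h) \<le> c * (norm h)\<^sup>2" for h
  proof -
    have "cinner (adj B h) h = cnj (cinner (B h) h)"
      by (metis adj_simps(1) cinner_commute)
    then have "Re (cinner (a h) h) = Re (cinner (B h) h)"
      by (simp add: a_def blinfun.bilinear_simps cinner.scaleR_left cinner_add_left)
    then show ?thesis using upper by simp
  qed
  then have "Re (f a) \<le> c" by (rule state_selfadjoint_le(2)[OF I f a])
  ultimately show ?thesis by simp
qed

lemma vector_state:
  assumes "norm h = 1"
  shows "is_state A (\<lambda>X. cinner (X h) h)"
  using assms
  by (auto simp: is_state_def positive_cone_def cinner_adj_left cstar_bounded_ops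
      blinfun.add_left cinner_add_left cinner_scaleC_left cinner_self)

end

lemma cmod_cinner_le_numerical_radius:
  fixes X :: "'h::chilbert_space \<Rightarrow>\<^sub>L 'h"
  assumes X: "X \<in> bounded_ops"
  shows "cmod (cinner (X h) h) \<le> numerical_radius X * (norm h)\<^sup>2"
proof (cases "h = 0")
  case False
  define g where "g = (1 / norm h) *\<^sub>R h"
  have g: "norm g = 1" "h = norm h *\<^sub>R g" using False by (simp_all add: g_def)
  have "bdd_above {cmod (cinner (X h) h) | h. norm h = 1}"
  proof (rule bdd_aboveI)
    fix x assume "x \<in> {cmod (cinner (X h) h) | h. norm h = 1}"
    then obtain h where h: "norm h = 1" "x = cmod (cinner (X h) h)" by blast
    then show "x \<le> norm X"
      using cinner_Cauchy_Schwarz[of "X h" h] norm_blinfun[of X h] by simp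
  qed
  then have "cmod (cinner (X g) g) \<le> numerical_radius X"
    unfolding numerical_radius_def using g by (intro cSup_upper) auto
  then have "cmod (cinner (X g) g) * (norm h)\<^sup>2 \<le> numerical_radius X * (norm h)\<^sup>2"
    by (rule mult_right_mono) simp
  moreover have "cinner (X h) h = of_real ((norm h)\<^sup>2) * cinner (X g) g"
    by (subst (1 2) g(2))
      (simp add: blinfun.scaleR_right cinner.scaleR_left cinner.scaleR_right
        scaleR_conv_of_real power2_eq_square)
  ultimately show ?thesis by (simp add: norm_mult norm_power mult.commute)
qed (simp add: cinner.zero_left)

theorem proposition5p8:
  fixes A :: "('h::chilbert_space \<Rightarrow>\<^sub>L 'h) set"
  assumes "\<exists>h::'h. h \<noteq> 0"
    and "cstar_algebra A"
    and "id_blinfun \<in> A"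
    and "X \<in> A"
  shows "min_order_norm A X = numerical_radius X"
proof (rule antisym)
  obtain k :: 'h where "k \<noteq> 0" using assms(1) by blast
  then have unit: "norm ((1 / norm k) *\<^sub>R k) = 1" by simp
  have state_le: "cmod (f X) \<le> numerical_radius X" if f: "is_state A f" for f
  proof -
    obtain u where u: "cmod u = 1" "u * f X = of_real (cmod (f X))"
      by (rule unimodular_rotation)
    have "Re (f (op_scaleC u X)) \<le> numerical_radius X"
    proof (rule state_Re_le[OF assms(2,3) f])
      show "op_scaleC u X \<in> A" using assms(2,4) by (rule cstar_scaleC)
      fix h
      have "Re (cinner (op_scaleC u X h) h) \<le> cmod (u * cinner (X h) h)"
        unfolding blinfun_apply_op_scaleC cinner_scaleC_left by (rule complex_Re_le_cmod)
      also have "\<dots> \<le> numerical_radius X * (norm h)\<^sup>2"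
        using cmod_cinner_le_numerical_radius[OF cstar_bounded_ops[OF assms(2,4)]]
        by (simp add: norm_mult u)
      finally show "Re (cinner (op_scaleC u X h) h) \<le> numerical_radius X * (norm h)\<^sup>2" .
    qed
    moreover have "f (op_scaleC u X) = u * f X" using f assms(4) by (simp add: is_state_def)
    ultimately show ?thesis by (simp add: u)
  qed
  show "min_order_norm A X \<le> numerical_radius X"
    unfolding min_order_norm_def
    using vector_state[OF assms(2) unit] state_le by (intro cSup_least) auto
  show "numerical_radius X \<le> min_order_norm A X"
    unfolding numerical_radius_def
  proof (rule cSup_least)
    show "{cmod (cinner (X h) h) | h. norm h = 1} \<noteq> {}" using unit by blast
    fix x assume "x \<in> {cmod (cinner (X h) h) | h. norm h = 1}"
    then obtain h where h: "norm h = 1" "x = cmod (cinner (X h) h)" by blast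
    show "x \<le> min_order_norm A X"
      unfolding min_order_norm_def
    proof (rule cSup_upper)
      show "x \<in> {cmod (f X) | f. is_state A f}"
        using vector_state[OF assms(2) h(1)] h(2) by (auto intro!: exI[of _ "\<lambda>X. cinner (X h) h"])
      show "bdd_above {cmod (f X) | f. is_state A f}"
        using state_le by (intro bdd_aboveI[where M = "numerical_radius X"]) auto
    qed
  qed
qed

end
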